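(* Let $\Omega$ be a Polish metric space and let $\mathbb{M}$ be a finite Borel measure over $\Omega$. Then $C_{b,u}(\Omega)$ is Lusin-dense in $L^{0}(\mathbb{M})$, i.e. $C_{b,u}(\Omega)$ is dense in $L^{0}(\mathbb{M})$ with respect to the Lusin topology of $L^{0}(\mathbb{M})$.
   Context: A Polish metric space is a metric space that is complete and separable with respect to its given metric. A Borel measure over a metric space $\Omega$ is a measure defined on the Borel sigma-algebra of $\Omega$ (generated by the topology induced by the given metric). $L^{0}(\mathbb{M})$ denotes the collection of all Borel functions $\Omega \to \mathbb{R}$ (actual functions, not equivalence classes), and $C_{b,u}(\Omega)$ denotes the collection of all bounded, uniformly continuous functions $\Omega \to \mathbb{R}$. For $f \in L^{0}(\mathbb{M})$ and $\varepsilon > 0$ let $$V(f,\varepsilon) := \{ g \in L^{0}(\mathbb{M}) \mid \mathbb{M}(\{x \in \Omega \mid f(x) \neq g(x)\}) < \varepsilon \}.$$ The Lusin topology of $L^{0}(\mathbb{M})$ is the topology generated by the family of all sets $V(f,\varepsilon)$, $f \in L^{0}(\mathbb{M})$, $\varepsilon > 0$; this family is a basis of it. *)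

theory Defs
  imports "HOL-Analysis.Analysis"
begin

definition C_bu :: "('a::metric_space \<Rightarrow> real) set" where
  "C_bu = {f. bounded (range f) \<and> uniformly_continuous_on UNIV f}"

abbreviation L0 :: "'a measure \<Rightarrow> ('a \<Rightarrow> real) set" where
  "L0 M \<equiv> borel_measurable M"

definition lusin_nbhd :: "'a measure \<Rightarrow> ('a \<Rightarrow> real) \<Rightarrow> real \<Rightarrow> ('a \<Rightarrow> real) set" where
  "lusin_nbhd M f \<epsilon> = {g \<in> L0 M. emeasure M {x \<in> space M. f x \<noteq> g x} < ennreal \<epsilon>}"

definition lusin_topology :: "'a measure \<Rightarrow> ('a \<Rightarrow> real) topology" where
  "lusin_topology M = topology_generated_by {lusin_nbhd M f \<epsilon> |f \<epsilon>. f \<in> L0 M \<and> \<epsilon> > 0}"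

lemma lusin_nbhd_self: "f \<in> L0 M \<Longrightarrow> \<epsilon> > 0 \<Longrightarrow> f \<in> lusin_nbhd M f \<epsilon>"
  by (simp add: lusin_nbhd_def)

lemma topspace_lusin_topology [simp]: "topspace (lusin_topology M) = L0 M"
proof -
  have "L0 M \<subseteq> \<Union> {lusin_nbhd M f \<epsilon> |f \<epsilon>. f \<in> L0 M \<and> \<epsilon> > 0}"
    using lusin_nbhd_self[of _ M 1] zero_less_one[where 'a = real] by blast
  then show ?thesis
    by (auto simp: lusin_topology_def lusin_nbhd_def)
qed

text \<open>Density includes the requirement that the subset lies in the space, since
  \<^const>\<open>closure_of\<close> ignores points outside of it.\<close>

definition dense_in :: "'a topology \<Rightarrow> 'a set \<Rightarrow> bool" where
  "dense_in X A \<longleftrightarrow> A \<subseteq> topspace X \<and> X closure_of A = topspace X"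

end

theory Submission
  imports Defs
begin

text \<open>
  The sets \<^term>\<open>lusin_nbhd M f e\<close> form a basis of the Lusin topology, so density says that each
  Borel function \<open>f\<close> agrees with a bounded, uniformly continuous function outside a set of measure
  less than a given \<open>e\<close>. The usual route restricts \<open>f\<close> to a compact set on which it is continuous
  (Lusin's theorem) and then needs an extension theorem of Tietze type that preserves uniform
  continuity. Binary expansions give the function directly, without any extension.

  Let \<open>f\<close> have values in \<open>[0, 1)\<close>. Then \<open>f = (\<Sum>n. (1/2) ^ (n + 1) * indicator (A n))\<close>,
  where \<open>A n\<close> is the Borel set on which the binary digit number \<open>n + 1\<close> of \<open>f\<close> is 1. A single
  indicator is easy: by inner regularity, \<open>A n\<close> and its complement are exhausted, up to a small
  measure, by compact sets; these are disjoint, hence a positive distance apart, and a truncated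
  multiple of the distance to one of them is a Lipschitz function with values in \<open>[0, 1]\<close> that
  equals the indicator on both (\<open>indicator_agrees_with_uniformly_continuous\<close>). If the exceptional
  sets have measures that sum to less than \<open>e\<close>, then \<open>f\<close> equals the series of these functions
  outside their union. The series is dominated by a geometric one, so it converges uniformly, and its
  sum is again bounded and uniformly continuous (\<open>frac_agrees_with_C_bu\<close>).

  For a general \<open>f\<close>, finiteness of the measure gives a bound \<open>b\<close> with \<open>\<bar>f\<bar> < b\<close> outside a small set.
  There \<open>(f + b) / (2 * b)\<close> lies in \<open>(0, 1)\<close> and so equals its fractional part, to which the bounded case
  applies (\<open>measurable_agrees_with_C_bu\<close>).
\<close>

section \<open>Uniformly continuous functions\<close>

lemma uniformly_continuous_on_uniform_limit:
  fixes g :: "'a::metric_space \<Rightarrow> 'b::metric_space"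
  assumes lim: "uniform_limit S f g F"
    and uc: "\<And>n. uniformly_continuous_on S (f n)"
    and "F \<noteq> bot"
  shows "uniformly_continuous_on S g"
  unfolding uniformly_continuous_on_def
proof (intro allI impI)
  fix e :: real
  assume "e > 0"
  then have "\<forall>\<^sub>F n in F. \<forall>x\<in>S. dist (f n x) (g x) < e / 3"
    by (intro uniform_limitD[OF lim]) auto
  then obtain n where n: "\<And>x. x \<in> S \<Longrightarrow> dist (f n x) (g x) < e / 3"
    using \<open>F \<noteq> bot\<close> eventually_happens' by blast
  obtain d where "d > 0"
    and d: "\<And>x y. \<lbrakk>x \<in> S; y \<in> S; dist y x < d\<rbrakk> \<Longrightarrow> dist (f n y) (f n x) < e / 3"
    using uc[of n] \<open>e > 0\<close> unfolding uniformly_continuous_on_def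
    by (metis divide_pos_pos zero_less_numeral)
  have "dist (g y) (g x) < e" if "x \<in> S" "y \<in> S" "dist y x < d" for x y
  proof -
    have "dist (g y) (g x) \<le> dist (f n y) (g y) + dist (f n y) (f n x) + dist (f n x) (g x)"
      using dist_triangle[of "g y" "g x" "f n y"] dist_triangle[of "f n y" "g x" "f n x"]
      by (simp add: dist_commute)
    then show ?thesis
      using n[OF that(1)] n[OF that(2)] d[OF that] by linarith
  qed
  then show "\<exists>d>0. \<forall>x\<in>S. \<forall>y\<in>S. dist y x < d \<longrightarrow> dist (g y) (g x) < e"
    using \<open>d > 0\<close> by blast
qed

text \<open>
  A Urysohn function for \<open>L\<close> and \<open>K\<close>. Compactness of \<open>K\<close> keeps it a positive distance \<open>d\<close> away
  from \<open>L\<close>; this is what makes the function uniformly continuous, which fails in general for two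
  disjoint closed sets.
\<close>

lemma uniformly_continuous_separation:
  fixes K L :: "'a::metric_space set"
  assumes "compact K" and "closed L" and "K \<inter> L = {}"
  obtains h :: "'a \<Rightarrow> real"
  where "uniformly_continuous_on UNIV h" and "\<And>x. h x \<in> {0..1}"
    and "\<And>x. x \<in> K \<Longrightarrow> h x = 1" and "\<And>x. x \<in> L \<Longrightarrow> h x = 0"
proof (cases "K = {} \<or> L = {}")
  case True
  have "uniformly_continuous_on UNIV (\<lambda>x::'a. if K = {} then 0 else 1 :: real)"
    by (rule uniformly_continuous_on_const)
  with True show ?thesis
    by (intro that[of "\<lambda>x. if K = {} then 0 else 1"]) auto
next
  case False
  \<comment> \<open>\<^const>\<open>infdist\<close> to the empty set is 0 by convention, so the formula below is for nonempty \<open>L\<close>.\<close>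
  have "continuous_on K (\<lambda>x. infdist x L)"
    by (intro continuous_intros)
  then obtain a where "a \<in> K" and a: "\<And>x. x \<in> K \<Longrightarrow> infdist a L \<le> infdist x L"
    using continuous_attains_inf[of K "\<lambda>x. infdist x L"] \<open>compact K\<close> False by blast
  define d where "d = infdist a L"
  have "d > 0"
    unfolding d_def using \<open>a \<in> K\<close> assms False by (intro infdist_pos_not_in_closed) auto
  define h where "h x = min 1 (infdist x L / d)" for x
  have "(1 / d)-lipschitz_on UNIV h"
  proof (rule lipschitz_onI)
    fix x y :: 'a
    have "dist (h x) (h y) \<le> \<bar>infdist x L / d - infdist y L / d\<bar>"
      by (auto simp: h_def dist_real_def min_def)
    also have "\<dots> = \<bar>infdist x L - infdist y L\<bar> / d"
      using \<open>d > 0\<close> by (simp add: diff_divide_distrib[symmetric])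
    also have "\<dots> \<le> dist x y / d"
      using \<open>d > 0\<close> by (intro divide_right_mono infdist_triangle_abs) auto
    finally show "dist (h x) (h y) \<le> 1 / d * dist x y" by simp
  qed (use \<open>d > 0\<close> in auto)
  then have "uniformly_continuous_on UNIV h"
    by (rule lipschitz_on_uniformly_continuous)
  moreover have "h x \<in> {0..1}" for x
    using \<open>d > 0\<close> infdist_nonneg[of x L] by (simp add: h_def)
  moreover have "h x = 1" if "x \<in> K" for x
    using a[OF that] \<open>d > 0\<close> by (simp add: h_def d_def[symmetric])
  moreover have "h x = 0" if "x \<in> L" for x
    using that by (simp add: h_def)
  ultimately show ?thesis by (rule that)
qed

section \<open>Binary digits\<close>

text \<open>
  The truncations \<open>\<lfloor>2 ^ n * x\<rfloor> / 2 ^ n\<close> tend to \<open>x\<close>, start at \<open>\<lfloor>x\<rfloor>\<close>, and grow in step \<open>n\<close> by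
  the next binary digit, so the series telescopes to \<open>x - \<lfloor>x\<rfloor>\<close>.
\<close>

lemma binary_digit_sums_frac:
  fixes x :: real
  shows "(\<lambda>n. (1/2) ^ Suc n * of_bool (odd \<lfloor>2 ^ Suc n * x\<rfloor>)) sums frac x"
proof -
  define a where "a n = real_of_int \<lfloor>2 ^ n * x\<rfloor> / 2 ^ n" for n :: nat
  have "a \<longlonglongrightarrow> x"
  proof (rule LIMSEQ_I)
    fix e :: real
    assume "e > 0"
    then obtain N :: nat where N: "(1/2) ^ N < e"
      using real_arch_pow_inv[of e "1/2"] by auto
    have "norm (a n - x) < e" if "n \<ge> N" for n
    proof -
      have "a n - x = - (frac (2 ^ n * x) / 2 ^ n)"
        by (simp add: a_def frac_def field_simps)
      then have "norm (a n - x) = frac (2 ^ n * x) / 2 ^ n"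
        by (simp add: frac_ge_0)
      also have "\<dots> \<le> 1 / 2 ^ n"
        using frac_lt_1[of "2 ^ n * x"] by (intro divide_right_mono) auto
      also have "\<dots> \<le> (1/2) ^ N"
        using power_decreasing[OF that, of "1/2::real"] by (simp add: power_one_over)
      finally show ?thesis using N by simp
    qed
    then show "\<exists>N. \<forall>n\<ge>N. norm (a n - x) < e" by blast
  qed
  then have "(\<lambda>n. a (Suc n) - a n) sums (x - a 0)"
    by (rule telescope_sums)
  moreover have "a (Suc n) - a n = (1/2) ^ Suc n * of_bool (odd \<lfloor>2 ^ Suc n * x\<rfloor>)" for n
  proof -
    define k where "k = \<lfloor>2 ^ Suc n * x\<rfloor>"
    have "k div 2 = \<lfloor>2 ^ n * x\<rfloor>"
      using floor_divide_real_eq_div[of 2 "2 ^ Suc n * x"] by (simp add: k_def)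
    moreover have "k = 2 * (k div 2) + of_bool (odd k)"
      by (simp only: of_bool_odd_eq_mod_2 mult_div_mod_eq)
    ultimately have "real_of_int k = 2 * real_of_int \<lfloor>2 ^ n * x\<rfloor> + of_bool (odd k)"
      by (metis of_int_add of_int_mult of_int_numeral of_int_of_bool)
    then show ?thesis
      unfolding a_def k_def[symmetric] by (simp add: field_simps)
  qed
  moreover have "x - a 0 = frac x"
    by (simp add: a_def frac_def)
  ultimately show ?thesis by (simp only:)
qed

section \<open>Agreement outside a set of small measure\<close>

text \<open>
  The range condition matters later: it lets a series of such functions, weighted by powers of 1/2,
  converge uniformly.
\<close>

lemma indicator_agrees_with_uniformly_continuous:
  fixes M :: "'a::polish_space measure"
  assumes "finite_measure M" and M: "sets M = sets borel" and A: "A \<in> sets M" and "e > 0"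
  obtains h :: "'a \<Rightarrow> real"
  where "uniformly_continuous_on UNIV h" and "\<And>x. h x \<in> {0..1}"
    and "measure M {x. h x \<noteq> indicator A x} < e"
proof -
  interpret finite_measure M by fact
  have space: "space M = UNIV"
    using sets_eq_imp_space_eq[OF M] by simp
  have compact_inside: "\<exists>K\<subseteq>B. compact K \<and> measure M (B - K) < e / 2" if "B \<in> sets M" for B
  proof -
    have inner: "emeasure M B = (SUP K \<in> {K. K \<subseteq> B \<and> compact K}. emeasure M K)"
      using that M by (intro inner_regular) (auto simp: emeasure_eq_measure)
    have "{K. K \<subseteq> B \<and> compact K} \<noteq> {}" and "emeasure M B \<noteq> \<infinity>"
      by (auto simp: emeasure_eq_measure)
    then have "\<exists>K\<in>{K. K \<subseteq> B \<and> compact K}. emeasure M B < emeasure M K + ennreal (e / 2)"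
      using \<open>e > 0\<close> by (intro SUP_approx_ennreal[OF _ _ inner]) simp_all
    then obtain K where K: "K \<subseteq> B" "compact K" "emeasure M B < emeasure M K + ennreal (e / 2)"
      by blast
    have "K \<in> sets M"
      using M \<open>compact K\<close> by (simp add: borel_compact)
    have "measure M B < measure M K + e / 2"
      using K(3) \<open>e > 0\<close>
      by (simp add: emeasure_eq_measure ennreal_plus[symmetric] ennreal_less_iff del: ennreal_plus)
    then have "measure M (B - K) < e / 2"
      using finite_measure_Diff[OF that \<open>K \<in> sets M\<close> \<open>K \<subseteq> B\<close>] by linarith
    with K show ?thesis by blast
  qed
  obtain K where K: "K \<subseteq> A" "compact K" "measure M (A - K) < e / 2"
    using compact_inside[OF A] by blast
  have "- A \<in> sets M"
    using sets.compl_sets[OF A] by (simp add: space Compl_eq_Diff_UNIV)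
  then obtain L where L: "L \<subseteq> - A" "compact L" "measure M (- A - L) < e / 2"
    using compact_inside by blast
  obtain h where h: "uniformly_continuous_on UNIV h" "\<And>x. h x \<in> {0..1::real}"
    "\<And>x. x \<in> K \<Longrightarrow> h x = 1" "\<And>x. x \<in> L \<Longrightarrow> h x = 0"
    using uniformly_continuous_separation[of K L] K L by (blast intro: compact_imp_closed)
  have KL: "K \<in> sets M" "L \<in> sets M"
    using K L M by (simp_all add: borel_compact)
  have "{x. h x \<noteq> indicator A x} \<subseteq> (A - K) \<union> (- A - L)"
    using h(3,4) by (auto simp: indicator_def)
  then have "measure M {x. h x \<noteq> indicator A x} \<le> measure M ((A - K) \<union> (- A - L))"
    using A \<open>- A \<in> sets M\<close> KL by (intro finite_measure_mono) auto
  also have "\<dots> \<le> measure M (A - K) + measure M (- A - L)"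
    using A \<open>- A \<in> sets M\<close> KL by (intro measure_Un_le) auto
  also have "\<dots> < e" using K L by linarith
  finally show ?thesis using h that by blast
qed

text \<open>
  Replacing each binary digit of \<open>u\<close> by a uniformly continuous function keeps the series uniformly
  convergent, and changes its sum only where some digit was changed. Since the digit series
  of any real number sums to its fractional part, \<open>frac\<close> is the form in which the bounded case is used.
\<close>

lemma frac_agrees_with_C_bu:
  fixes M :: "'a::polish_space measure"
  assumes "finite_measure M" and M: "sets M = sets borel"
    and u: "u \<in> borel_measurable M" and "e > 0"
  obtains g where "g \<in> C_bu" and "measure M {x. frac (u x) \<noteq> g x} < e"
proof -
  interpret finite_measure M by fact
  have space: "space M = UNIV"
    using sets_eq_imp_space_eq[OF M] by simp
  define A where "A n = {x. odd \<lfloor>2 ^ Suc n * u x\<rfloor>}" for n :: nat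
  have A: "A n \<in> sets M" for n
  proof -
    have "{x \<in> space M. odd \<lfloor>2 ^ Suc n * u x\<rfloor>} \<in> sets M"
      using u by measurable
    then show ?thesis by (simp add: A_def space)
  qed
  \<comment> \<open>The errors add up to \<open>e / 2\<close> rather than \<open>e\<close>, because the strict bound on each term becomes
    a weak one for the sum.\<close>
  let ?e = "\<lambda>n. e / 2 * (1/2) ^ Suc n"
  have "\<exists>h. uniformly_continuous_on UNIV h \<and> (\<forall>x. h x \<in> {0..1::real})
      \<and> measure M {x. h x \<noteq> indicator (A n) x} < ?e n" for n
  proof -
    have "?e n > 0" using \<open>e > 0\<close> by simp
    then obtain h :: "'a \<Rightarrow> real"
      where "uniformly_continuous_on UNIV h" and "\<And>x. h x \<in> {0..1}"
        and "measure M {x. h x \<noteq> indicator (A n) x} < ?e n"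
      using indicator_agrees_with_uniformly_continuous[OF assms(1) M A[of n]] by blast
    then show ?thesis by blast
  qed
  then obtain h :: "nat \<Rightarrow> 'a \<Rightarrow> real" where h_uc: "\<And>n. uniformly_continuous_on UNIV (h n)"
    and h_range: "\<And>n x. h n x \<in> {0..1}"
    and h_small: "\<And>n. measure M {x. h n x \<noteq> indicator (A n) x} < ?e n"
    by metis
  define t where "t n x = (1/2) ^ Suc n * h n x" for n x
  define g where "g x = (\<Sum>n. t n x)" for x
  have t_bound: "norm (t n x) \<le> (1/2) ^ Suc n" for n x
    using h_range[of n x] by (simp add: t_def abs_mult mult_left_le)
  have half: "(\<lambda>n. (1/2::real) ^ Suc n) sums 1" by (rule power_half_series)
  have "uniform_limit UNIV (\<lambda>n x. \<Sum>i<n. t i x) g sequentially"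
    unfolding g_def using t_bound sums_summable[OF half] by (rule Weierstrass_m_test)
  moreover have "uniformly_continuous_on UNIV (\<lambda>x. \<Sum>i<n. t i x)" for n
    unfolding t_def
    by (induction n) (auto intro!: uniformly_continuous_on_add
        bounded_linear.uniformly_continuous_on[OF bounded_linear_mult_right]
        uniformly_continuous_on_const h_uc simp del: power_Suc)
  ultimately have g_uc: "uniformly_continuous_on UNIV g"
    by (rule uniformly_continuous_on_uniform_limit) simp
  have "norm (g x) \<le> 1" for x
    unfolding g_def using norm_suminf_le[OF t_bound sums_summable[OF half]] sums_unique[OF half]
    by simp
  then have "bounded (range g)"
    by (auto simp: bounded_iff)
  with g_uc have "g \<in> C_bu" by (simp add: C_bu_def)
  let ?D = "\<lambda>n. {x. h n x \<noteq> indicator (A n) x}"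
  have D: "?D n \<in> sets M" for n
  proof -
    have "h n \<in> borel_measurable M"
      using uniformly_continuous_imp_continuous[OF h_uc[of n]] M
      by (simp add: borel_measurable_continuous_onI cong: measurable_cong_sets)
    then have "{x \<in> space M. h n x \<noteq> indicator (A n) x} \<in> sets M"
      using A[of n] by measurable
    then show ?thesis by (simp add: space)
  qed
  have e_sums: "?e sums (e / 2)"
    using sums_mult[OF half, of "e / 2"] by simp
  have D_summable: "summable (\<lambda>n. measure M (?D n))"
    using h_small by (intro summable_comparison_test[OF _ sums_summable[OF e_sums]])
      (auto intro!: exI[of _ 0] less_imp_le)
  have "{x. frac (u x) \<noteq> g x} \<subseteq> (\<Union>n. ?D n)"
  proof (rule ccontr)
    assume "\<not> ?thesis"
    then obtain x where x: "frac (u x) \<noteq> g x" "\<And>n. h n x = indicator (A n) x"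
      by blast
    then have "g x = frac (u x)"
      using sums_unique[OF binary_digit_sums_frac[of "u x"]]
      by (simp add: g_def t_def A_def indicator_def of_bool_def)
    with x show False by simp
  qed
  then have "measure M {x. frac (u x) \<noteq> g x} \<le> measure M (\<Union>n. ?D n)"
    using D by (intro finite_measure_mono) auto
  also have "\<dots> \<le> (\<Sum>n. measure M (?D n))"
    using D D_summable by (intro finite_measure_subadditive_countably) auto
  also have "\<dots> \<le> e / 2"
    using suminf_le[OF less_imp_le[OF h_small] D_summable sums_summable[OF e_sums]]
      sums_unique[OF e_sums] by simp
  also have "\<dots> < e" using \<open>e > 0\<close> by simp
  finally show ?thesis using \<open>g \<in> C_bu\<close> that by blast
qed

text \<open>
  The sets where \<open>\<bar>f\<bar> \<ge> n\<close> decrease to the empty set, and a finite measure is continuous from above.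
\<close>

lemma measurable_small_outside_bounded:
  fixes f :: "'a \<Rightarrow> real"
  assumes "finite_measure M" and f: "f \<in> borel_measurable M" and "e > 0"
  obtains b where "b > 0" and "measure M {x \<in> space M. \<bar>f x\<bar> \<ge> b} < e"
proof -
  interpret finite_measure M by fact
  let ?T = "\<lambda>n::nat. {x \<in> space M. \<bar>f x\<bar> \<ge> real n}"
  have "(\<lambda>n. measure M (?T n)) \<longlonglongrightarrow> measure M (\<Inter>n. ?T n)"
    using f by (intro finite_Lim_measure_decseq) (auto simp: decseq_def)
  moreover have "(\<Inter>n. ?T n) = {}"
  proof -
    have "\<exists>n. \<bar>f x\<bar> < real n" for x
      by (rule reals_Archimedean2)
    then show ?thesis by (force simp flip: not_less)
  qed
  ultimately have "(\<lambda>n. measure M (?T n)) \<longlonglongrightarrow> 0" by simp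
  then have "\<forall>\<^sub>F n in sequentially. measure M (?T n) < e"
    using \<open>e > 0\<close> by (rule order_tendstoD)
  with eventually_gt_at_top[of 0] have "\<forall>\<^sub>F n in sequentially. n > 0 \<and> measure M (?T n) < e"
    by eventually_elim simp
  then obtain n where "n > 0" "measure M (?T n) < e"
    using eventually_happens' sequentially_bot by blast
  then show ?thesis by (intro that[of "real n"]) auto
qed

lemma C_bu_affine:
  assumes "g \<in> C_bu"
  shows "(\<lambda>x. a * g x + b) \<in> C_bu"
proof -
  have "bounded ((\<lambda>y. a * y + b) ` range g)"
    using assms bounded_scaling[of "range g" a] bounded_translation[of "(*\<^sub>R) a ` range g" b]
    by (simp add: C_bu_def image_image add.commute)
  moreover have "uniformly_continuous_on UNIV (\<lambda>x. a * g x + b)"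
    using assms by (auto simp: C_bu_def intro!: uniformly_continuous_on_add
        bounded_linear.uniformly_continuous_on[OF bounded_linear_mult_right]
        uniformly_continuous_on_const)
  ultimately show ?thesis by (simp add: C_bu_def image_image)
qed

proposition measurable_agrees_with_C_bu:
  fixes M :: "'a::polish_space measure"
  assumes "finite_measure M" and M: "sets M = sets borel"
    and f: "f \<in> borel_measurable M" and "e > 0"
  obtains g where "g \<in> C_bu" and "measure M {x. f x \<noteq> g x} < e"
proof -
  interpret finite_measure M by fact
  have space: "space M = UNIV"
    using sets_eq_imp_space_eq[OF M] by simp
  obtain b where "b > 0" and b: "measure M {x \<in> space M. \<bar>f x\<bar> \<ge> b} < e / 2"
    using measurable_small_outside_bounded[OF assms(1) f, of "e / 2"] \<open>e > 0\<close> by auto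
  \<comment> \<open>Maps \<open>\<bar>f x\<bar> < b\<close> into \<open>(0, 1)\<close>, where \<^const>\<open>frac\<close> is the identity.\<close>
  define u where "u x = (f x + b) / (2 * b)" for x
  have u: "u \<in> borel_measurable M"
    unfolding u_def using f by measurable
  obtain g where g: "g \<in> C_bu" "measure M {x. frac (u x) \<noteq> g x} < e / 2"
    using frac_agrees_with_C_bu[OF assms(1) M u, of "e / 2"] \<open>e > 0\<close> by auto
  let ?g = "\<lambda>x. 2 * b * g x + - b"
  let ?B = "{x \<in> space M. \<bar>f x\<bar> \<ge> b}" and ?D = "{x \<in> space M. frac (u x) \<noteq> g x}"
  have "g \<in> borel_measurable M"
    using g M by (auto simp: C_bu_def cong: measurable_cong_sets
        intro!: borel_measurable_continuous_onI uniformly_continuous_imp_continuous)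
  then have meas: "?B \<in> sets M" "?D \<in> sets M"
    using f u unfolding frac_def by measurable
  have "{x. f x \<noteq> ?g x} \<subseteq> ?B \<union> ?D"
  proof (rule ccontr)
    assume "\<not> ?thesis"
    then obtain x where x: "f x \<noteq> ?g x" "\<bar>f x\<bar> < b" "frac (u x) = g x"
      by (auto simp: space not_le)
    from x(2) \<open>b > 0\<close> have "frac (u x) = u x"
      by (auto simp: frac_eq u_def field_simps)
    with x(1,3) \<open>b > 0\<close> show False
      by (auto simp: u_def field_simps)
  qed
  then have "measure M {x. f x \<noteq> ?g x} \<le> measure M (?B \<union> ?D)"
    using meas by (intro finite_measure_mono) auto
  also have "\<dots> \<le> measure M ?B + measure M ?D"
    using meas by (intro measure_Un_le)
  also have "\<dots> < e"
    using b g(2) by (simp add: space)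
  finally show ?thesis
    using C_bu_affine[OF g(1)] that by blast
qed

section \<open>The Lusin topology\<close>

text \<open>
  The measure of the set where two functions differ satisfies the triangle inequality, so the slack
  \<open>e - M {f \<noteq> g}\<close> serves as a radius around \<open>g\<close>, as for balls in a metric space.
\<close>

lemma lusin_nbhd_shrink:
  assumes g: "g \<in> lusin_nbhd M f e" and f: "f \<in> L0 M"
  obtains d where "d > 0" and "lusin_nbhd M g d \<subseteq> lusin_nbhd M f e"
proof -
  let ?m = "\<lambda>h k. emeasure M {x \<in> space M. h x \<noteq> (k x :: real)}"
  have gm: "g \<in> L0 M" and lt: "?m f g < ennreal e"
    using g by (auto simp: lusin_nbhd_def)
  obtain r where r: "?m f g = ennreal r" "r \<ge> 0"
    using lt by (cases "?m f g") auto
  have "r < e"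
    using lt r by (simp add: ennreal_less_iff)
  have "lusin_nbhd M g (e - r) \<subseteq> lusin_nbhd M f e"
  proof
    fix h
    assume "h \<in> lusin_nbhd M g (e - r)"
    then have hm: "h \<in> L0 M" and h: "?m g h < ennreal (e - r)"
      by (auto simp: lusin_nbhd_def)
    have fg: "{x \<in> space M. f x \<noteq> g x} \<in> sets M" and gh: "{x \<in> space M. g x \<noteq> h x} \<in> sets M"
      using f gm hm by measurable
    have "?m f h \<le> emeasure M ({x \<in> space M. f x \<noteq> g x} \<union> {x \<in> space M. g x \<noteq> h x})"
      using fg gh by (intro emeasure_mono) auto
    also have "\<dots> \<le> ?m f g + ?m g h"
      using fg gh by (rule emeasure_subadditive)
    also have "\<dots> < ennreal r + ennreal (e - r)"
      using h r by (simp add: ennreal_add_left_cancel_less)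
    also have "\<dots> = ennreal e"
      using r \<open>r < e\<close> by (simp add: ennreal_plus[symmetric] del: ennreal_plus)
    finally show "h \<in> lusin_nbhd M f e"
      using hm by (simp add: lusin_nbhd_def)
  qed
  with \<open>r < e\<close> show ?thesis
    by (intro that[of "e - r"]) auto
qed

lemma lusin_nbhd_mono:
  assumes "d \<le> e"
  shows "lusin_nbhd M f d \<subseteq> lusin_nbhd M f e"
proof
  fix g
  assume "g \<in> lusin_nbhd M f d"
  then have "g \<in> L0 M" and "emeasure M {x \<in> space M. f x \<noteq> g x} < ennreal d"
    by (simp_all add: lusin_nbhd_def)
  with ennreal_leI[OF assms] show "g \<in> lusin_nbhd M f e"
    unfolding lusin_nbhd_def by (simp add: order.strict_trans2)
qed

text \<open>
  The generating family is a neighbourhood basis: a generated open set is a union of finite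
  intersections of members that need not be centred at \<open>f\<close>, and shrinking recentres them.
\<close>

lemma openin_lusin_topology_contains_nbhd:
  assumes "openin (lusin_topology M) U" and "f \<in> U"
  obtains e where "e > 0" and "lusin_nbhd M f e \<subseteq> U"
proof -
  have "generate_topology_on {lusin_nbhd M f \<epsilon> |f \<epsilon>. f \<in> L0 M \<and> \<epsilon> > 0} U"
    using assms(1) unfolding lusin_topology_def by (rule openin_topology_generated_by)
  then have "\<forall>f\<in>U. \<exists>e>0. lusin_nbhd M f e \<subseteq> U"
  proof induction
    case (Int a b)
    show ?case
    proof
      fix f
      assume "f \<in> a \<inter> b"
      then obtain d e where "d > 0" "lusin_nbhd M f d \<subseteq> a" "e > 0" "lusin_nbhd M f e \<subseteq> b"
        using Int.IH by blast
      then show "\<exists>e>0. lusin_nbhd M f e \<subseteq> a \<inter> b"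
        using lusin_nbhd_mono[of "min d e" d M f] lusin_nbhd_mono[of "min d e" e M f]
        by (intro exI[of _ "min d e"]) auto
    qed
  next
    case (UN \<K>)
    then show ?case by (meson Union_iff Union_upper order_trans)
  next
    case (Basis U)
    then obtain g e where "g \<in> L0 M" "U = lusin_nbhd M g e" by blast
    then show ?case using lusin_nbhd_shrink[of _ M g e] by metis
  qed simp
  with \<open>f \<in> U\<close> that show ?thesis by blast
qed

theorem theorem1:
  fixes M :: "'a::polish_space measure"
  assumes "finite_measure M"
    and "sets M = sets borel"
  shows "dense_in (lusin_topology M) C_bu"
proof -
  interpret finite_measure M by fact
  have space: "space M = UNIV"
    using sets_eq_imp_space_eq[OF assms(2)] by simp
  have C_bu_meas: "C_bu \<subseteq> L0 M"
    using assms(2) by (auto simp: C_bu_def cong: measurable_cong_sets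
        intro!: borel_measurable_continuous_onI uniformly_continuous_imp_continuous)
  have "f \<in> lusin_topology M closure_of C_bu" if f: "f \<in> L0 M" for f
    unfolding in_closure_of
  proof (intro conjI allI impI)
    show "f \<in> topspace (lusin_topology M)"
      using f by simp
  next
    fix U
    assume "f \<in> U \<and> openin (lusin_topology M) U"
    then obtain e where "e > 0" "lusin_nbhd M f e \<subseteq> U"
      using openin_lusin_topology_contains_nbhd[of M U f] by metis
    moreover obtain g where g: "g \<in> C_bu" "measure M {x. f x \<noteq> g x} < e"
      using measurable_agrees_with_C_bu[OF assms f \<open>e > 0\<close>] by blast
    then have "g \<in> lusin_nbhd M f e"
      using C_bu_meas \<open>e > 0\<close>
      by (auto simp: lusin_nbhd_def space emeasure_eq_measure ennreal_less_iff)
    ultimately show "\<exists>g. g \<in> C_bu \<and> g \<in> U"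
      using g(1) by blast
  qed
  then show ?thesis
    using C_bu_meas closure_of_subset_topspace[of "lusin_topology M" C_bu]
    by (auto simp: dense_in_def)
qed

end
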